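(* For every positive integer $k$ there exists $\epsilon>0$ such that for every sufficiently large integer $n$ there exists a digraph $D$ on $n$ vertices with the following two properties: - $\chi(D)>k$; - $\chi(D[S])\le 2$ for every $S\subseteq V(D)$ with $|S|\le\epsilon n$.
   Context: Digraphs are loopless. A set $A\subseteq V(D)$ is acyclic if the induced subdigraph $D[A]$ contains no directed cycle. The chromatic number $\chi(D)$ of a digraph $D$ is the minimum integer $k$ such that $V(D)$ can be partitioned into at most $k$ acyclic sets. $D[S]$ denotes the subdigraph induced by $S$. *)

theory Defs
  imports Complex_Main "HOL-Library.Disjoint_Sets" "Graph_Theory.Graph_Theory"
begin

definition acyclic_set :: "('a, 'b) pre_digraph \<Rightarrow> 'a set \<Rightarrow> bool" where
  "acyclic_set D A \<longleftrightarrow> A \<subseteq> verts D \<and> \<not> (\<exists>p. pre_digraph.cycle (D \<restriction> A) p)"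

text \<open>The minimum exists for every finite loopless digraph, since singletons are then acyclic;
  if no finite acyclic partition exists, the value is unspecified.\<close>

definition chromatic_number :: "('a, 'b) pre_digraph \<Rightarrow> nat" where
  "chromatic_number D = (LEAST k. \<exists>P. partition_on (verts D) P \<and> finite P \<and> card P \<le> k \<and>
     (\<forall>A\<in>P. acyclic_set D A))"

end

theory Submission
  imports Defs
begin

text \<open>
  Let every one of the \<open>n\<close> vertices choose \<open>d\<close> out-neighbours uniformly and independently, and
  discard the loops. An acyclic set with at least \<open>2h\<close> vertices contains, by cutting a
  topological order, two disjoint \<open>h\<close>-sets \<open>X\<close>, \<open>Y\<close> without an arc from \<open>Y\<close> to \<open>X\<close>; for given
  \<open>X\<close>, \<open>Y\<close> this happens with probability \<open>(1 - h/n)\<^sup>d\<^sup>h\<close>, which beats the \<open>4\<^sup>n\<close> choices of \<open>(X, Y)\<close>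
  once \<open>d h\<^sup>2 \<ge> 4 n\<^sup>2\<close>. A set of \<open>s\<close> vertices spans at least \<open>2s\<close> of the chosen arcs with
  probability at most \<open>2\<^sup>d\<^sup>s (s/n)\<^sup>2\<^sup>s\<close>, and since there are at most \<open>(e n/s)\<^sup>s\<close> such sets, with
  positive probability no set of at most \<open>\<epsilon>n\<close> vertices does. Then every nonempty subset of a small
  set has a vertex of in-degree at most 1 within it; colour the rest by induction and give this
  vertex the colour not used by its in-neighbour, so that it becomes a source of its class.
\<close>

subsection \<open>Acyclic relations\<close>

text \<open>No walk inside \<open>insert v A\<close> can enter \<open>v\<close>, so a closed walk
  stays in \<open>A\<close>. This is the recolouring step for a vertex that becomes a source of its
  class.\<close>

lemma acyclic_insert_source:
  assumes "acyclic (r \<inter> A \<times> A)" and "\<And>u. u \<in> insert v A \<Longrightarrow> (u, v) \<notin> r"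
  shows "acyclic (r \<inter> insert v A \<times> insert v A)"
proof -
  have step: "y \<in> A \<and> (x \<in> A \<longrightarrow> (x, y) \<in> (r \<inter> A \<times> A)\<^sup>+)"
    if "(x, y) \<in> (r \<inter> insert v A \<times> insert v A)\<^sup>+" for x y
    using that
  proof (induction rule: trancl_induct)
    case (base y)
    with assms(2) show ?case by auto
  next
    case (step y z)
    then have "z \<in> A" "(y, z) \<in> r \<inter> A \<times> A" using assms(2) by auto
    with step.IH show ?case by (auto intro: trancl_into_trancl)
  qed
  show ?thesis
    using step assms(1) unfolding acyclic_def by blast
qed

text \<open>This cuts a topological order after \<open>j\<close> elements: \<open>X\<close> grows by
  a minimal element of what remains, whose in-neighbours in \<open>A\<close> all lie in
  \<open>X\<close> already.\<close>

lemma acyclic_initial_segment: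
  assumes "finite A" "acyclic (r \<inter> A \<times> A)" "j \<le> card A"
  shows "\<exists>X\<subseteq>A. card X = j \<and> (\<forall>y\<in>A - X. \<forall>x\<in>X. (y, x) \<notin> r)"
  using assms(3)
proof (induction j)
  case 0
  show ?case by (intro exI[of _ "{}"]) auto
next
  case (Suc j)
  then obtain X where X: "X \<subseteq> A" "card X = j" "\<forall>y\<in>A - X. \<forall>x\<in>X. (y, x) \<notin> r" by auto
  have "finite (r \<inter> A \<times> A)" using assms(1) by blast
  then have wf: "wf (r \<inter> A \<times> A)" using assms(2) by (rule finite_acyclic_wf)
  have "A - X \<noteq> {}" using X Suc.prems by auto
  then obtain v where v: "v \<in> A - X" "\<And>y. (y, v) \<in> r \<inter> A \<times> A \<Longrightarrow> y \<notin> A - X"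
    using wf by (meson all_not_in_conv wfE_min)
  have "card (insert v X) = Suc j"
    using X v assms(1) finite_subset by (metis DiffD2 card_insert_disjoint)
  moreover have "\<forall>y\<in>A - insert v X. \<forall>x\<in>insert v X. (y, x) \<notin> r" using X v by auto
  moreover have "insert v X \<subseteq> A" using X v by auto
  ultimately show ?case by blast
qed

text \<open>The average in-degree in each nonempty \<open>T\<close> is below 2, so some vertex has
  at most one in-neighbour there. This passes to subsets, which permits induction on
  \<open>S\<close> by removing that vertex.\<close>

lemma acyclic_bipartition_of_sparse:
  assumes "finite S" "irrefl r"
    and "\<And>T. T \<subseteq> S \<Longrightarrow> T \<noteq> {} \<Longrightarrow> card (r \<inter> T \<times> T) < 2 * card T"
  shows "\<exists>A\<subseteq>S. acyclic (r \<inter> A \<times> A) \<and> acyclic (r \<inter> (S - A) \<times> (S - A))"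
  using assms(1,3)
proof (induction S rule: finite_psubset_induct)
  case (psubset S)
  show ?case
  proof (cases "S = {}")
    case True
    then show ?thesis by (simp add: acyclic_def)
  next
    case False
    define N where "N v = {u\<in>S. (u, v) \<in> r}" for v
    \<comment> \<open>Arcs are grouped by their head, so that their number is the sum of the
      in-degrees.\<close>
    have "r \<inter> S \<times> S = prod.swap ` (SIGMA v:S. N v)"
      unfolding N_def by (auto simp: image_iff)
    then have "card (r \<inter> S \<times> S) = card (SIGMA v:S. N v)"
      by (simp add: card_image)
    also have "\<dots> = (\<Sum>v\<in>S. card (N v))"
      using psubset.hyps by (simp add: N_def)
    finally have sum: "(\<Sum>v\<in>S. card (N v)) < 2 * card S"
      using psubset.prems[of S] False by simp
    have "\<exists>v\<in>S. card (N v) < 2"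
    proof (rule ccontr)
      assume "\<not> ?thesis"
      then have "(\<Sum>v\<in>S. 2) \<le> (\<Sum>v\<in>S. card (N v))" by (intro sum_mono) force
      with sum show False by simp
    qed
    then obtain v where v: "v \<in> S" "card (N v) \<le> 1" by force
    have one: "u = w" if "u \<in> N v" "w \<in> N v" for u w
      using v psubset.hyps that by (auto simp: N_def card_le_Suc0_iff_eq)
    have "\<exists>A\<subseteq>S - {v}. acyclic (r \<inter> A \<times> A) \<and> acyclic (r \<inter> (S - {v} - A) \<times> (S - {v} - A))"
      using psubset.prems v by (intro psubset.IH) auto
    then obtain A where A: "A \<subseteq> S - {v}" "acyclic (r \<inter> A \<times> A)"
      "acyclic (r \<inter> (S - {v} - A) \<times> (S - {v} - A))" by blast
    have loop: "(v, v) \<notin> r" using assms(2) by (simp add: irrefl_def)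
    show ?thesis
    proof (cases "N v \<inter> A = {}")
      case True
      then have "acyclic (r \<inter> insert v A \<times> insert v A)"
        using A loop by (intro acyclic_insert_source) (auto simp: N_def)
      moreover have "S - insert v A = S - {v} - A" by auto
      ultimately show ?thesis using A v by (intro exI[of _ "insert v A"]) auto
    next
      \<comment> \<open>The only in-neighbour of \<open>v\<close> lies in \<open>A\<close>, so
        \<open>v\<close> is a source in the other class.\<close>
      case False
      then have "acyclic (r \<inter> insert v (S - {v} - A) \<times> insert v (S - {v} - A))"
        using A loop one by (intro acyclic_insert_source) (auto simp: N_def)
      moreover have "S - A = insert v (S - {v} - A)" using A v by auto
      ultimately show ?thesis using A by (intro exI[of _ A]) auto
    qed
  qed
qed

subsection \<open>Digraphs given by a relation\<close>

text \<open>Arcs are the pairs themselves, which rules out parallel arcs. Cutting \<open>r\<close>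
  down to \<open>V\<close> here means that an induced subdigraph keeps the same \<open>r\<close> and
  only changes \<open>V\<close>.\<close>

definition rel_digraph :: "'a set \<Rightarrow> ('a \<times> 'a) set \<Rightarrow> ('a, 'a \<times> 'a) pre_digraph" where
  "rel_digraph V r = \<lparr>verts = V, arcs = r \<inter> V \<times> V, tail = fst, head = snd\<rparr>"

lemma verts_rel_digraph [simp]: "verts (rel_digraph V r) = V"
  by (simp add: rel_digraph_def)

lemma digraph_rel_digraph:
  assumes "finite V" "irrefl r"
  shows "digraph (rel_digraph V r)"
proof
  show "finite (arcs (rel_digraph V r))"
    using assms(1) by (simp add: rel_digraph_def)
qed (use assms in \<open>auto simp: rel_digraph_def irrefl_def arc_to_ends_def\<close>)

lemma induce_subgraph_rel_digraph:
  assumes "A \<subseteq> V"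
  shows "rel_digraph V r \<restriction> A = rel_digraph A r"
  using assms by (auto simp: rel_digraph_def induce_subgraph_def)

text \<open>A cycle is a nonempty closed walk, and every nonempty closed walk contains a cycle. This
  moves the whole problem to relations.\<close>

lemma (in wf_digraph) acyclic_arcs_ends_iff: "acyclic (arcs_ends G) \<longleftrightarrow> \<not> (\<exists>p. cycle p)"
proof
  assume "acyclic (arcs_ends G)"
  then show "\<not> (\<exists>p. cycle p)"
    unfolding cycle_def acyclic_def using reachable1_awalkI by blast
next
  assume "\<not> (\<exists>p. cycle p)"
  then have "\<not> (\<exists>p. closed_w p)" using closed_w_imp_cycle by blast
  then show "acyclic (arcs_ends G)"
    unfolding acyclic_def closed_w_def by (auto simp: reachable1_awalk)
qed

lemma acyclic_set_rel_digraph: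
  "acyclic_set (rel_digraph V r) A \<longleftrightarrow> A \<subseteq> V \<and> acyclic (r \<inter> A \<times> A)"
proof -
  interpret wf_digraph "rel_digraph A r"
    by unfold_locales (auto simp: rel_digraph_def)
  have "arcs_ends (rel_digraph A r) = r \<inter> A \<times> A"
    by (auto simp: rel_digraph_def arcs_ends_conv image_iff)
  then show ?thesis
    using acyclic_arcs_ends_iff induce_subgraph_rel_digraph[of A V r]
    by (auto simp: acyclic_set_def)
qed

lemma chromatic_number_rel_digraph_le_2:
  assumes "A \<subseteq> V" "acyclic (r \<inter> A \<times> A)" "acyclic (r \<inter> (V - A) \<times> (V - A))"
  shows "chromatic_number (rel_digraph V r) \<le> 2"
  unfolding chromatic_number_def
proof (rule Least_le, intro exI conjI ballI)
  \<comment> \<open>Blocks of a partition are nonempty, so an empty colour class has to be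
    dropped.\<close>
  let ?P = "{A, V - A} - {{}}"
  show "partition_on (verts (rel_digraph V r)) ?P"
    using assms(1) by (auto simp: partition_on_def disjoint_def)
  have "card ?P \<le> card {A, V - A}" by (intro card_mono) auto
  also have "\<dots> \<le> 2" by (simp add: card_insert_if)
  finally show "card ?P \<le> 2" .
qed (use assms in \<open>auto simp: acyclic_set_rel_digraph\<close>)

text \<open>The singletons, acyclic because \<open>r\<close> has no loops, show that some
  \<open>k\<close> qualifies; hence the \<open>LEAST\<close> is attained by a partition.\<close>

lemma chromatic_number_rel_digraph_attained:
  assumes "finite V" "irrefl r"
  obtains P where "partition_on V P" "finite P" "card P \<le> chromatic_number (rel_digraph V r)"
    "\<And>A. A \<in> P \<Longrightarrow> acyclic (r \<inter> A \<times> A)"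
proof -
  let ?Q = "\<lambda>k P. partition_on (verts (rel_digraph V r)) P \<and> finite P \<and> card P \<le> k \<and>
     (\<forall>A\<in>P. acyclic_set (rel_digraph V r) A)"
  have "\<exists>P. ?Q (card ((\<lambda>v. {v}) ` V)) P"
  proof (intro exI conjI ballI)
    show "partition_on (verts (rel_digraph V r)) ((\<lambda>v. {v}) ` V)"
      by (auto simp: partition_on_def disjoint_def)
    fix A assume "A \<in> (\<lambda>v. {v}) ` V"
    then obtain v where v: "A = {v}" "v \<in> V" by auto
    then have "r \<inter> A \<times> A = {}" using assms(2) by (auto simp: irrefl_def)
    with v show "acyclic_set (rel_digraph V r) A"
      by (simp add: acyclic_set_rel_digraph acyclic_def)
  qed (use assms(1) in auto)
  then have "\<exists>P. ?Q (chromatic_number (rel_digraph V r)) P"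
    unfolding chromatic_number_def by (rule LeastI)
  then show ?thesis using that by (auto simp: acyclic_set_rel_digraph)
qed

text \<open>Among at most \<open>k\<close> classes one has at least \<open>2 * h\<close> vertices.
  The first \<open>h\<close> of them in a topological order, and \<open>h\<close> later ones, form a
  forbidden pair.\<close>

lemma chromatic_number_rel_digraph_gt:
  assumes "finite V" "irrefl r" "V \<noteq> {}" "2 * k * h \<le> card V"
    and no_gap: "\<And>X Y. \<lbrakk>X \<subseteq> V; Y \<subseteq> V; X \<inter> Y = {}; card X = h; card Y = h\<rbrakk>
      \<Longrightarrow> \<exists>y\<in>Y. \<exists>x\<in>X. (y, x) \<in> r"
  shows "chromatic_number (rel_digraph V r) > k"
proof (rule ccontr)
  assume "\<not> ?thesis"
  then obtain P where P: "partition_on V P" "finite P" "card P \<le> k"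
    "\<And>A. A \<in> P \<Longrightarrow> acyclic (r \<inter> A \<times> A)"
    using chromatic_number_rel_digraph_attained[OF assms(1,2)] by (metis le_trans linorder_not_less)
  have fin: "finite A" if "A \<in> P" for A
    using that P(1) assms(1) finite_subset[of A V] by (auto simp: partition_on_def)
  have "\<exists>A\<in>P. 2 * h \<le> card A"
  proof (rule ccontr)
    assume "\<not> ?thesis"
    then have less: "\<And>A. A \<in> P \<Longrightarrow> card A < 2 * h" by force
    have "P \<noteq> {}" using P(1) assms(3) by (auto simp: partition_on_def)
    have "card V = (\<Sum>A\<in>P. card A)"
      using P(1) fin card_Union_disjoint[of P]
      by (simp add: partition_on_def disjoint_def pairwise_def disjnt_def)
    also have "\<dots> < (\<Sum>A\<in>P. 2 * h)"
      using less \<open>P \<noteq> {}\<close> P(2) by (intro sum_strict_mono) auto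
    also have "\<dots> \<le> k * (2 * h)" using P(3) by simp
    finally show False using assms(4) by (simp add: ac_simps)
  qed
  then obtain A where A: "A \<in> P" "2 * h \<le> card A" by blast
  then obtain X where X: "X \<subseteq> A" "card X = h" "\<forall>y\<in>A - X. \<forall>x\<in>X. (y, x) \<notin> r"
    using acyclic_initial_segment[of A r h] fin P(4) by auto
  have "h \<le> card (A - X)"
    using X A fin by (simp add: card_Diff_subset finite_subset)
  then obtain Y where Y: "Y \<subseteq> A - X" "card Y = h"
    using obtain_subset_with_card_n by metis
  have "A \<subseteq> V" using A P(1) by (auto simp: partition_on_def)
  with no_gap[of X Y] X Y show False by blast
qed

subsection \<open>Counting maps\<close>

text \<open>The coordinates in \<open>T\<close> land in \<open>S\<close> independently, each with
  probability \<open>card S / card V\<close>; the last factor is the number of all maps.\<close>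

lemma card_PiE_restricted:
  assumes "finite I" "T \<subseteq> I" "finite V" "V \<noteq> {}" "S \<subseteq> V"
  shows "real (card {f \<in> I \<rightarrow>\<^sub>E V. \<forall>t\<in>T. f t \<in> S}) =
    (card S / card V) ^ card T * card V ^ card I"
proof -
  have "{f \<in> I \<rightarrow>\<^sub>E V. \<forall>t\<in>T. f t \<in> S} = (\<Pi>\<^sub>E i\<in>I. if i \<in> T then S else V)"
    using assms(2,5) by (fastforce simp: PiE_iff split: if_splits)
  moreover have "card (\<Pi>\<^sub>E i\<in>I. if i \<in> T then S else V) = card S ^ card T * card V ^ (card I - card T)"
  proof -
    have "card (\<Pi>\<^sub>E i\<in>I. if i \<in> T then S else V) = (\<Prod>i\<in>I. if i \<in> T then card S else card V)"
      using assms(1) by (subst card_PiE) (auto intro: prod.cong)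
    also have "\<dots> = card S ^ card (I \<inter> T) * card V ^ card (I - T)"
      using assms(1) by (simp add: prod.If_cases Diff_eq)
    also have "I \<inter> T = T" using assms(2) by auto
    also have "card (I - T) = card I - card T"
      using assms(1,2) by (simp add: card_Diff_subset finite_subset)
    finally show ?thesis .
  qed
  moreover have "real (card V) ^ card I = card V ^ card T * card V ^ (card I - card T)"
    using assms(1,2) by (simp add: card_mono flip: power_add)
  moreover have "card V > 0" using assms(3,4) by (simp add: card_gt_0_iff)
  ultimately show ?thesis by (simp add: power_divide)
qed

text \<open>This is the bound \<open>(e n / s)^s\<close> for the binomial coefficient, free of
  division by \<open>s\<close>. The term of index \<open>s\<close> in the series of
  \<open>exp s\<close> gives \<open>s^s / fact s \<le> exp s\<close>.\<close>

lemma binomial_mult_power_le: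
  "real (n choose s) * real s ^ s \<le> (exp 1 * real n) ^ s"
proof -
  have "real s ^ s / fact s \<le> exp (real s)"
  proof -
    have "(\<Sum>i\<in>{s}. real s ^ i /\<^sub>R fact i) \<le> (\<Sum>i. real s ^ i /\<^sub>R fact i)"
      using summable_exp_generic[of "real s"] by (intro sum_le_suminf) auto
    then show ?thesis by (simp add: exp_def divide_inverse_commute)
  qed
  then have "real s ^ s \<le> exp 1 ^ s * fact s"
    by (simp add: field_simps flip: exp_of_nat_mult)
  then have "real (n choose s) * real s ^ s \<le> real (n choose s) * (exp 1 ^ s * fact s)"
    by (intro mult_left_mono) auto
  also have "\<dots> = exp 1 ^ s * real ((n choose s) * fact s)" by simp
  also have "\<dots> \<le> exp 1 ^ s * real (n ^ s)"
    by (intro mult_left_mono) (use binomial_fact_pow in \<open>auto simp only: of_nat_le_iff exp_ge_zero zero_le_power\<close>)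
  finally show ?thesis by (simp add: power_mult_distrib)
qed

lemma sum_power_fourth_less: "(\<Sum>s\<in>{1..n}. (1/4::real) ^ s) < 1/2"
proof -
  have "(\<Sum>s\<in>{1..n}. (1/4::real) ^ s) = (1 - (1/4) ^ n) / 3"
    by (induction n) (auto simp: algebra_simps)
  also have "\<dots> < 1/2" by (simp add: field_simps add_pos_pos)
  finally show ?thesis .
qed

text \<open>The left side will bound the probability of a gap: \<open>4 ^ n\<close> pairs of sets
  times the bound for one pair. It is small since \<open>exp 4 \<ge> 16\<close>.\<close>

lemma four_power_mult_exp_le:
  assumes "n > 0"
  shows "4 ^ n * exp (- 4 * real n) \<le> 1 / 4"
proof -
  have "(2::real) ^ 4 \<le> exp 1 ^ 4"
    using exp_ge_add_one_self[of 1] by (intro power_mono) auto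
  then have "exp (4::real) \<ge> 16" by (simp flip: exp_of_nat_mult)
  then have "4 * exp (- 4::real) \<le> 1 / 4" by (simp add: exp_minus field_simps)
  then have "(4 * exp (- 4::real)) ^ n \<le> (1 / 4) ^ n" by (intro power_mono) auto
  also have "\<dots> \<le> (1 / 4) ^ 1" using assms by (intro power_decreasing) auto
  also have "(4 * exp (- 4::real)) ^ n = 4 ^ n * exp (- 4 * real n)"
    by (simp add: power_mult_distrib mult.commute flip: exp_of_nat_mult)
  finally show ?thesis by simp
qed

text \<open>This is the probabilistic argument as a count: \<open>f (y, i)\<close> is the
  \<open>i\<close>-th choice of \<open>y\<close>, and the maps violating either conclusion number
  less than 3/4 of all maps.\<close>

lemma exists_sparse_expanding_map:
  fixes n d h :: nat and \<epsilon> :: real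
  assumes "n > 0" "h \<le> n" "4 * n\<^sup>2 \<le> d * h\<^sup>2" "exp 1 * 2 ^ d * \<epsilon> \<le> 1 / 4"
  obtains f :: "nat \<times> nat \<Rightarrow> nat" where
    "\<And>X Y. \<lbrakk>X \<subseteq> {..<n}; Y \<subseteq> {..<n}; card X = h; card Y = h\<rbrakk> \<Longrightarrow> \<exists>y\<in>Y. \<exists>i<d. f (y, i) \<in> X"
    "\<And>S. \<lbrakk>S \<subseteq> {..<n}; S \<noteq> {}; real (card S) \<le> \<epsilon> * n\<rbrakk>
      \<Longrightarrow> card {t \<in> S \<times> {..<d}. f t \<in> S} < 2 * card S"
proof -
  define V where "V = {..<n}"
  define I where "I = V \<times> {..<d}"
  define F where "F = I \<rightarrow>\<^sub>E V"
  define M where "M = real n ^ card I"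
  \<comment> \<open>Both failures have this shape: all choices made in \<open>Y\<close> miss
    \<open>X\<close>, or some \<open>2 * card S\<close> choices made in \<open>S\<close> stay in
    \<open>S\<close>.\<close>
  define B where "B S T = {f \<in> F. \<forall>t\<in>T. f t \<in> S}" for S T
  have V: "finite V" "V \<noteq> {}" "card V = n" using assms(1) by (auto simp: V_def)
  have I: "finite I" using V by (simp add: I_def)
  have F: "finite F" "real (card F) = M"
    using I V by (auto simp: F_def M_def finite_PiE card_PiE)
  have "M > 0" using assms(1) by (simp add: M_def)
  have B: "real (card (B S T)) = (card S / n) ^ card T * M" if "S \<subseteq> V" "T \<subseteq> I" for S T
    using card_PiE_restricted[OF I that(2) V(1,2) that(1)] V(3) by (simp add: B_def F_def M_def)
  have card_UN: "real (card (\<Union>q\<in>Q. W q)) \<le> card Q * c"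
    if "finite Q" "\<And>q. q \<in> Q \<Longrightarrow> real (card (W q)) \<le> c"
    for Q :: "'q set" and W :: "'q \<Rightarrow> (nat \<times> nat \<Rightarrow> nat) set" and c :: real
  proof -
    have "real (card (\<Union>q\<in>Q. W q)) \<le> real (\<Sum>q\<in>Q. card (W q))"
      using card_UN_le[OF that(1)] by (simp only: of_nat_le_iff)
    also have "\<dots> \<le> card Q * c" using that(2) sum_bounded_above[of Q "\<lambda>q. real (card (W q))"] by simp
    finally show ?thesis .
  qed

  define Q where "Q = {X. X \<subseteq> V \<and> card X = h} \<times> {Y. Y \<subseteq> V \<and> card Y = h}"
  define B1 where "B1 = (\<Union>q\<in>Q. B (V - fst q) (snd q \<times> {..<d}))"
  have Q: "finite Q" using V by (auto simp: Q_def)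
  have B1: "real (card B1) \<le> M / 4"
  proof -
    have "real (card (B (V - fst q) (snd q \<times> {..<d}))) \<le> exp (- 4 * real n) * M" if qQ: "q \<in> Q" for q
    proof -
      obtain X Y where q: "q = (X, Y)" "X \<subseteq> V" "Y \<subseteq> V" "card X = h" "card Y = h"
        using qQ by (auto simp: Q_def)
      have "real (card (V - X)) = real n - h"
        using q V assms(2) by (simp add: card_Diff_subset finite_subset of_nat_diff)
      then have "real (card (B (V - X) (Y \<times> {..<d}))) = ((real n - h) / n) ^ (h * d) * M"
        using q by (subst B) (auto simp: I_def card_cartesian_product)
      \<comment> \<open>With \<open>1 - x \<le> exp (- x)\<close> for \<open>x = h / n\<close>, the
        exponent becomes \<open>- d h^2 / n\<close>, which is at most \<open>- 4 n\<close> by the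
        hypothesis on \<open>d\<close>.\<close>
      also have "((real n - h) / n) ^ (h * d) \<le> exp (- 4 * real n)"
      proof -
        have "real (4 * n\<^sup>2) \<le> real (d * h\<^sup>2)" using assms(3) by (simp only: of_nat_le_iff)
        then have dh: "4 * real n \<le> real (h * d) * (real h / real n)"
          using assms(1) by (simp add: field_simps power2_eq_square)
        have "(real n - h) / n = 1 + (- (real h / real n))"
          using assms(1) by (simp add: field_simps)
        moreover have "\<dots> \<le> exp (- (real h / real n))" by (rule exp_ge_add_one_self)
        moreover have "0 \<le> (real n - h) / n" using assms(2) by simp
        ultimately have "((real n - h) / n) ^ (h * d) \<le> exp (- (real h / real n)) ^ (h * d)"
          by (intro power_mono) auto
        also have "\<dots> = exp (- (real (h * d) * (real h / real n)))"
          by (simp only: exp_of_nat_mult[symmetric] mult_minus_right)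
        also have "\<dots> \<le> exp (- 4 * real n)" using dh by simp
        finally show ?thesis .
      qed
      finally show ?thesis using q \<open>M > 0\<close> by simp
    qed
    then have "real (card B1) \<le> card Q * (exp (- 4 * real n) * M)"
      unfolding B1_def by (intro card_UN Q) auto
    also have "\<dots> \<le> 4 ^ n * (exp (- 4 * real n) * M)"
    proof -
      have "card Q \<le> card (Pow V \<times> Pow V)"
        unfolding Q_def using V by (intro card_mono) auto
      also have "\<dots> = 4 ^ n"
        using V by (simp add: card_cartesian_product card_Pow flip: power_mult_distrib)
      finally have "real (card Q) \<le> real (4 ^ n)" by (simp only: of_nat_le_iff)
      then show ?thesis using \<open>M > 0\<close> by (intro mult_right_mono) auto
    qed
    also have "\<dots> = (4 ^ n * exp (- 4 * real n)) * M" by simp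
    also have "\<dots> \<le> 1 / 4 * M"
      using four_power_mult_exp_le assms(1) \<open>M > 0\<close> by (intro mult_right_mono) auto
    finally show ?thesis by simp
  qed

  \<comment> \<open>Exactly \<open>2 * s\<close> choices are prescribed, since any larger set of
    choices contains such a \<open>T\<close>.\<close>
  define C where "C s = (SIGMA S:{S. S \<subseteq> V \<and> card S = s}. {T. T \<subseteq> S \<times> {..<d} \<and> card T = 2 * s})" for s
  define U where "U s = (\<Union>q\<in>C s. B (fst q) (snd q))" for s
  \<comment> \<open>The size 0 must be left out: \<open>U 0\<close> would be all of
    \<open>F\<close>.\<close>
  define J where "J = {s \<in> {1..n}. real s \<le> \<epsilon> * n}"
  have finS: "finite S" if "S \<subseteq> V" for S using V that finite_subset by blast
  have U: "real (card (U s)) \<le> (1 / 4) ^ s * M" if "s \<in> J" for s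
  proof -
    have s: "s > 0" "real s \<le> \<epsilon> * n" using that by (auto simp: J_def)
    have fin: "finite {S. S \<subseteq> V \<and> card S = s}"
      "\<And>S. S \<in> {S. S \<subseteq> V \<and> card S = s} \<Longrightarrow> finite {T. T \<subseteq> S \<times> {..<d} \<and> card T = 2 * s}"
      using V finS by auto
    then have "finite (C s)" unfolding C_def by auto
    then have "real (card (U s)) \<le> card (C s) * ((s / n) ^ (2 * s) * M)"
      unfolding U_def
    proof (rule card_UN)
      fix q assume "q \<in> C s"
      then obtain S T where q: "q = (S, T)" "S \<subseteq> V" "card S = s" "T \<subseteq> S \<times> {..<d}" "card T = 2 * s"
        by (auto simp: C_def)
      then have "T \<subseteq> I" by (auto simp: I_def)
      with B[of S T] q show "real (card (B (fst q) (snd q))) \<le> (s / n) ^ (2 * s) * M" by simp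
    qed
    also have "\<dots> \<le> (real (n choose s) * (2 ^ d) ^ s) * ((s / n) ^ (2 * s) * M)"
    proof -
      have "card (C s) = (\<Sum>S | S \<subseteq> V \<and> card S = s. card {T. T \<subseteq> S \<times> {..<d} \<and> card T = 2 * s})"
        unfolding C_def using fin by (intro card_SigmaI) auto
      also have "\<dots> \<le> (\<Sum>S | S \<subseteq> V \<and> card S = s. (2 ^ d) ^ s)"
      proof (rule sum_mono)
        fix S assume S: "S \<in> {S. S \<subseteq> V \<and> card S = s}"
        have "card {T. T \<subseteq> S \<times> {..<d} \<and> card T = 2 * s} \<le> card (Pow (S \<times> {..<d}))"
          using S finS by (intro card_mono) auto
        also have "\<dots> = (2 ^ d) ^ s"
          using S finS by (simp add: card_Pow card_cartesian_product mult.commute flip: power_mult)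
        finally show "card {T. T \<subseteq> S \<times> {..<d} \<and> card T = 2 * s} \<le> (2 ^ d) ^ s" .
      qed
      also have "\<dots> = (n choose s) * (2 ^ d) ^ s" using V n_subsets[of V s] by simp
      finally have "real (card (C s)) \<le> real ((n choose s) * (2 ^ d) ^ s)" by (simp only: of_nat_le_iff)
      then show ?thesis using \<open>M > 0\<close> by (intro mult_right_mono) auto
    qed
    \<comment> \<open>Of the two factors \<open>(s / n) ^ s\<close>, one offsets the number of sets
      \<open>S\<close>; the other survives and is made small by \<epsilon>. This is why two arcs per
      vertex are counted.\<close>
    also have "\<dots> = (real (n choose s) * real s ^ s) * ((2 ^ d * s / n\<^sup>2) ^ s * M)"
      by (simp add: power_mult_distrib power_divide power2_eq_square power_mult)
    also have "\<dots> \<le> (exp 1 * real n) ^ s * ((2 ^ d * s / n\<^sup>2) ^ s * M)"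
      using \<open>M > 0\<close> by (intro mult_right_mono binomial_mult_power_le) auto
    also have "\<dots> = (exp 1 * real n * (2 ^ d * s / n\<^sup>2)) ^ s * M"
      by (simp only: power_mult_distrib mult.assoc)
    also have "exp 1 * real n * (2 ^ d * s / n\<^sup>2) = exp 1 * 2 ^ d * (s / n)"
      using assms(1) by (simp add: power2_eq_square)
    also have "(exp 1 * 2 ^ d * (real s / n)) ^ s * M \<le> (1 / 4) ^ s * M"
    proof (intro mult_right_mono power_mono)
      have "real s / n \<le> \<epsilon>" using s assms(1) by (simp add: field_simps)
      then have "exp 1 * 2 ^ d * (s / n) \<le> exp 1 * 2 ^ d * \<epsilon>" by (intro mult_left_mono) auto
      with assms(4) show "exp 1 * 2 ^ d * (s / n) \<le> 1 / 4" by (rule order_trans[rotated])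
    qed (use \<open>M > 0\<close> in auto)
    finally show ?thesis .
  qed
  have "real (card (\<Union>s\<in>J. U s)) \<le> real (\<Sum>s\<in>J. card (U s))"
    using card_UN_le[of J U] by (simp only: of_nat_le_iff) (simp add: J_def)
  also have "\<dots> \<le> (\<Sum>s\<in>J. (1 / 4) ^ s * M)"
    unfolding of_nat_sum by (intro sum_mono U)
  also have "\<dots> \<le> (\<Sum>s\<in>{1..n}. (1 / 4) ^ s * M)"
    using \<open>M > 0\<close> by (intro sum_mono2) (auto simp: J_def)
  also have "\<dots> < 1 / 2 * M"
    using sum_power_fourth_less[of n] \<open>M > 0\<close> unfolding sum_distrib_right[symmetric]
    by (intro mult_strict_right_mono)
  \<comment> \<open>The two kinds of bad maps contribute at most \<open>M / 4\<close> and less than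
    \<open>M / 2\<close>.\<close>
  finally have "real (card (B1 \<union> (\<Union>s\<in>J. U s))) < M"
    using B1 \<open>M > 0\<close> card_Un_le[of B1 "\<Union>s\<in>J. U s"] by linarith
  moreover have "B1 \<union> (\<Union>s\<in>J. U s) \<subseteq> F" by (auto simp: B1_def U_def B_def)
  ultimately have "B1 \<union> (\<Union>s\<in>J. U s) \<subset> F" using F(2) by auto
  then obtain f where f: "f \<in> F" "f \<notin> B1" "\<And>s. s \<in> J \<Longrightarrow> f \<notin> U s" by blast
  show ?thesis
  proof
    fix X Y assume XY: "X \<subseteq> {..<n}" "Y \<subseteq> {..<n}" "card X = h" "card Y = h"
    then have "(X, Y) \<in> Q" by (simp add: Q_def V_def)
    with f have "f \<notin> B (V - X) (Y \<times> {..<d})" unfolding B1_def by force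
    then obtain y i where "y \<in> Y" "i < d" "f (y, i) \<notin> V - X" using f by (auto simp: B_def)
    moreover from this XY f have "f (y, i) \<in> V" by (auto simp: F_def I_def V_def)
    ultimately show "\<exists>y\<in>Y. \<exists>i<d. f (y, i) \<in> X" by auto
  next
    fix S assume S: "S \<subseteq> {..<n}" "S \<noteq> {}" "real (card S) \<le> \<epsilon> * n"
    show "card {t \<in> S \<times> {..<d}. f t \<in> S} < 2 * card S"
    proof (rule ccontr)
      assume "\<not> ?thesis"
      then have "2 * card S \<le> card {t \<in> S \<times> {..<d}. f t \<in> S}" by simp
      then obtain T where T: "T \<subseteq> {t \<in> S \<times> {..<d}. f t \<in> S}" "card T = 2 * card S"
        by (rule obtain_subset_with_card_n)
      have "finite S" using S finite_subset by blast
      then have "card S \<in> J" using S card_mono[of "{..<n}" S] by (auto simp: J_def Suc_le_eq card_gt_0_iff)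
      moreover have "(S, T) \<in> C (card S)" using S T by (auto simp: C_def V_def)
      moreover have "f \<in> B S T" using f T by (auto simp: B_def)
      ultimately show False using f(3) by (force simp: U_def)
    qed
  qed
qed

section \<open>Choice of the constants and conclusion\<close>

theorem theorem3:
  shows "\<forall>k::nat. k > 0 \<longrightarrow> (\<exists>\<epsilon>::real. \<epsilon> > 0 \<and> (\<exists>N::nat. \<forall>n\<ge>N.
    \<exists>D :: (nat, nat \<times> nat) pre_digraph. digraph D \<and> card (verts D) = n \<and>
      chromatic_number D > k \<and>
      (\<forall>S \<subseteq> verts D. real (card S) \<le> \<epsilon> * real n \<longrightarrow> chromatic_number (D \<restriction> S) \<le> 2)))"
proof (intro allI impI)
  fix k :: nat assume "k > 0"
  \<comment> \<open>For \<open>h = n div (2 * k)\<close> and \<open>h \<ge> 1\<close> one has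
    \<open>n \<le> 4 * k * h\<close>, hence \<open>4 n^2 \<le> 64 k^2 h^2\<close>. The value of
    \<epsilon> then solves \<open>exp 1 * 2 ^ d * \<epsilon> = 1 / 4\<close>.\<close>
  define d where "d = 64 * k\<^sup>2"
  define \<epsilon> :: real where "\<epsilon> = 1 / (4 * exp 1 * 2 ^ d)"
  have "\<exists>D :: (nat, nat \<times> nat) pre_digraph. digraph D \<and> card (verts D) = n \<and>
      chromatic_number D > k \<and>
      (\<forall>S \<subseteq> verts D. real (card S) \<le> \<epsilon> * real n \<longrightarrow> chromatic_number (D \<restriction> S) \<le> 2)"
    if n: "n \<ge> 2 * k" for n
  proof -
    define h where "h = n div (2 * k)"
    have h: "2 * k * h \<le> n" by (simp add: h_def)
    have "h \<ge> 1" using n \<open>k > 0\<close> by (simp add: h_def div_greater_zero_iff Suc_le_eq)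
    have "n < 2 * k * (h + 1)"
      unfolding h_def using \<open>k > 0\<close> dividend_less_times_div[of "2 * k" n] by simp
    also have "\<dots> \<le> 2 * k * (2 * h)" using \<open>h \<ge> 1\<close> by (intro mult_left_mono) auto
    finally have "n\<^sup>2 \<le> (4 * k * h)\<^sup>2" by (intro power_mono) auto
    then have dh: "4 * n\<^sup>2 \<le> d * h\<^sup>2" by (simp add: d_def power_mult_distrib mult_ac)
    have "h \<le> n" by (simp add: h_def)
    have "n > 0" using n \<open>k > 0\<close> by simp
    have eps: "exp 1 * 2 ^ d * \<epsilon> \<le> 1 / 4" by (simp add: \<epsilon>_def)
    obtain f :: "nat \<times> nat \<Rightarrow> nat" where f:
      "\<And>X Y. \<lbrakk>X \<subseteq> {..<n}; Y \<subseteq> {..<n}; card X = h; card Y = h\<rbrakk> \<Longrightarrow> \<exists>y\<in>Y. \<exists>i<d. f (y, i) \<in> X"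
      "\<And>S. \<lbrakk>S \<subseteq> {..<n}; S \<noteq> {}; real (card S) \<le> \<epsilon> * n\<rbrakk>
        \<Longrightarrow> card {t \<in> S \<times> {..<d}. f t \<in> S} < 2 * card S"
      using exists_sparse_expanding_map[OF \<open>n > 0\<close> \<open>h \<le> n\<close> dh eps] by blast
    define r where "r = {(v, w). v \<noteq> w \<and> (\<exists>i<d. w = f (v, i))}"
    have "irrefl r" by (auto simp: r_def irrefl_def)
    have "chromatic_number (rel_digraph {..<n} r) > k"
    proof (rule chromatic_number_rel_digraph_gt)
      fix X Y assume XY: "X \<subseteq> {..<n}" "Y \<subseteq> {..<n}" "X \<inter> Y = {}" "card X = h" "card Y = h"
      with f(1) obtain y i where "y \<in> Y" "i < d" "f (y, i) \<in> X" by blast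
      \<comment> \<open>Disjointness of \<open>X\<close> and \<open>Y\<close> guarantees that this
        choice is not a discarded loop.\<close>
      moreover from this XY have "(y, f (y, i)) \<in> r" by (auto simp: r_def)
      ultimately show "\<exists>y\<in>Y. \<exists>x\<in>X. (y, x) \<in> r" by blast
    qed (use \<open>irrefl r\<close> \<open>n > 0\<close> h in auto)
    moreover have "chromatic_number (rel_digraph {..<n} r \<restriction> S) \<le> 2"
      if S: "S \<subseteq> {..<n}" "real (card S) \<le> \<epsilon> * n" for S
    proof -
      have "finite S" using S finite_subset by blast
      moreover have "card (r \<inter> T \<times> T) < 2 * card T" if T: "T \<subseteq> S" "T \<noteq> {}" for T
      proof -
        let ?R = "{t \<in> T \<times> {..<d}. f t \<in> T}"
        have "finite T" using T \<open>finite S\<close> finite_subset by blast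
        then have fin: "finite ?R" by simp
        \<comment> \<open>Every arc comes from some choice; repeated choices and loops only make the
          arcs fewer than the choices.\<close>
        have "r \<inter> T \<times> T \<subseteq> (\<lambda>t. (fst t, f t)) ` ?R" by (force simp: r_def)
        then have "card (r \<inter> T \<times> T) \<le> card ?R"
          using fin by (meson card_image_le card_mono finite_imageI le_trans)
        also have "\<dots> < 2 * card T"
        proof (rule f(2))
          show "real (card T) \<le> \<epsilon> * n"
            using S T \<open>finite S\<close> card_mono[of S T] by linarith
        qed (use S T in auto)
        finally show ?thesis .
      qed
      ultimately obtain A where "A \<subseteq> S" "acyclic (r \<inter> A \<times> A)" "acyclic (r \<inter> (S - A) \<times> (S - A))"
        using acyclic_bipartition_of_sparse[of S r] \<open>irrefl r\<close> by blast
      then show ?thesis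
        using S by (simp add: induce_subgraph_rel_digraph chromatic_number_rel_digraph_le_2)
    qed
    ultimately show ?thesis
      using \<open>irrefl r\<close> by (intro exI[of _ "rel_digraph {..<n} r"]) (simp add: digraph_rel_digraph)
  qed
  moreover have "\<epsilon> > 0" by (simp add: \<epsilon>_def)
  ultimately show "\<exists>\<epsilon>::real. \<epsilon> > 0 \<and> (\<exists>N::nat. \<forall>n\<ge>N.
    \<exists>D :: (nat, nat \<times> nat) pre_digraph. digraph D \<and> card (verts D) = n \<and>
      chromatic_number D > k \<and>
      (\<forall>S \<subseteq> verts D. real (card S) \<le> \<epsilon> * real n \<longrightarrow> chromatic_number (D \<restriction> S) \<le> 2))"
    by blast
qed

end
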